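(* Let $A$ and $B$ be strictly positive operators on a Hilbert space $H$ such that $uA\le B\le vA$ for real numbers $u,v>0$ with $v\le1$, and let $p,q\in(0,1]$. If $p\le q$, then $$\frac{A\sharp_pB-A!_pB}{p}\ \ge\ \frac{A\sharp_qB-A!_qB}{q}.$$
   Context: An operator $A\in B(H)$ (bounded linear operators on a Hilbert space $H$) is strictly positive, $A>0$, if $A\ge 0$ and $A$ is invertible. For self-adjoint $X,Y$, $X\le Y$ means $Y-X$ is positive semidefinite. For $A,B>0$ and $p\in[0,1]$: the $p$-weighted geometric operator mean is $A\sharp_pB=A^{1/2}(A^{-1/2}BA^{-1/2})^pA^{1/2}$, and the $p$-weighted harmonic operator mean is $A!_pB=\{(1-p)A^{-1}+pB^{-1}\}^{-1}$. *)

theory Defs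
  imports "HOL-Analysis.Analysis" "HOL-Computational_Algebra.Polynomial"
begin

text \<open>
  Complex Hilbert spaces. The real inner product inherited from \<^class>\<open>real_inner\<close> is the real
  part of the complex one, so that \<open>norm x ^ 2 = Re (cinner x x)\<close> and positive definiteness
  of \<open>cinner\<close> are inherited as well. \<open>cinner\<close> is linear in its first argument.
\<close>

class chilbert = real_inner + complete_space +
  fixes scaleC :: "complex \<Rightarrow> 'a \<Rightarrow> 'a" (infixr \<open>*\<^sub>C\<close> 75)
    and cinner :: "'a \<Rightarrow> 'a \<Rightarrow> complex"
  assumes scaleC_add_right: "c *\<^sub>C (x + y) = c *\<^sub>C x + c *\<^sub>C y"
    and scaleC_add_left: "(c + d) *\<^sub>C x = c *\<^sub>C x + d *\<^sub>C x"
    and scaleC_scaleC: "c *\<^sub>C d *\<^sub>C x = (c * d) *\<^sub>C x"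
    and scaleR_scaleC: "r *\<^sub>R x = complex_of_real r *\<^sub>C x"
    and cinner_commute: "cinner x y = cnj (cinner y x)"
    and cinner_add_left: "cinner (x + y) z = cinner x z + cinner y z"
    and cinner_scaleC_left: "cinner (c *\<^sub>C x) y = c * cinner x y"
    and inner_eq_Re_cinner: "inner x y = Re (cinner x y)"

instantiation complex :: chilbert
begin

definition scaleC_complex :: "complex \<Rightarrow> complex \<Rightarrow> complex"
  where "scaleC_complex c x = c * x"

definition cinner_complex :: "complex \<Rightarrow> complex \<Rightarrow> complex"
  where "cinner_complex x y = x * cnj y"

instance
  by standard (simp_all add: scaleC_complex_def cinner_complex_def algebra_simps
      scaleR_conv_of_real inner_complex_def)

end

text \<open>
  \<open>B(H)\<close> is the set of complex-linear elements of the type of bounded real-linear operators;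
  this type carries the operator norm.
\<close>

definition bop :: "('a::chilbert \<Rightarrow>\<^sub>L 'a) set" where
  "bop = {A. \<forall>c x. blinfun_apply A (c *\<^sub>C x) = c *\<^sub>C blinfun_apply A x}"

definition selfadjoint :: "('a::chilbert \<Rightarrow>\<^sub>L 'a) \<Rightarrow> bool" where
  "selfadjoint A \<longleftrightarrow> A \<in> bop \<and>
     (\<forall>x y. cinner (blinfun_apply A x) y = cinner x (blinfun_apply A y))"

definition positive_op :: "('a::chilbert \<Rightarrow>\<^sub>L 'a) \<Rightarrow> bool" where
  "positive_op A \<longleftrightarrow> selfadjoint A \<and> (\<forall>x. 0 \<le> Re (cinner (blinfun_apply A x) x))"

definition op_le :: "('a::chilbert \<Rightarrow>\<^sub>L 'a) \<Rightarrow> ('a \<Rightarrow>\<^sub>L 'a) \<Rightarrow> bool" (infix \<open>\<preceq>\<close> 50) where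
  "X \<preceq> Y \<longleftrightarrow> selfadjoint X \<and> selfadjoint Y \<and> positive_op (Y - X)"

definition is_op_inverse :: "('a::chilbert \<Rightarrow>\<^sub>L 'a) \<Rightarrow> ('a \<Rightarrow>\<^sub>L 'a) \<Rightarrow> bool" where
  "is_op_inverse A C \<longleftrightarrow> C \<in> bop \<and> A o\<^sub>L C = id_blinfun \<and> C o\<^sub>L A = id_blinfun"

definition op_inv :: "('a::chilbert \<Rightarrow>\<^sub>L 'a) \<Rightarrow> ('a \<Rightarrow>\<^sub>L 'a)" where
  "op_inv A = (THE C. is_op_inverse A C)"

definition strictly_positive :: "('a::chilbert \<Rightarrow>\<^sub>L 'a) \<Rightarrow> bool" where
  "strictly_positive A \<longleftrightarrow> positive_op A \<and> (\<exists>C. is_op_inverse A C)"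

definition spectrum_op :: "('a::chilbert \<Rightarrow>\<^sub>L 'a) \<Rightarrow> complex set" where
  "spectrum_op A = {z. \<not> (\<exists>C. is_op_inverse (A - Blinfun (\<lambda>x. z *\<^sub>C x)) C)}"

definition op_poly :: "real poly \<Rightarrow> ('a::chilbert \<Rightarrow>\<^sub>L 'a) \<Rightarrow> ('a \<Rightarrow>\<^sub>L 'a)" where
  "op_poly P A = (\<Sum>i\<le>degree P. coeff P i *\<^sub>R (((\<lambda>T. A o\<^sub>L T) ^^ i) id_blinfun))"

text \<open>
  Continuous functional calculus \<open>f(A)\<close> for self-adjoint \<open>A\<close> (whose spectrum is real) and real
  \<open>f\<close> continuous on the spectrum: the norm limit of \<open>P\<^sub>n(A)\<close> for real polynomials \<open>P\<^sub>n\<close> converging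
  to \<open>f\<close> uniformly on the spectrum. For other \<open>A\<close> or \<open>f\<close> the value is not meaningful.
  In particular \<open>op_powr A r\<close> is used only for strictly positive \<open>A\<close>, where \<open>t powr r\<close> is
  continuous on the spectrum also for \<open>r < 0\<close>.
\<close>

definition fun_calc :: "(real \<Rightarrow> real) \<Rightarrow> ('a::chilbert \<Rightarrow>\<^sub>L 'a) \<Rightarrow> ('a \<Rightarrow>\<^sub>L 'a)" where
  "fun_calc f A = (THE T. T \<in> bop \<and>
     (\<forall>P :: nat \<Rightarrow> real poly.
        uniform_limit {t. complex_of_real t \<in> spectrum_op A} (\<lambda>n. poly (P n)) f sequentially
        \<longrightarrow> (\<lambda>n. op_poly (P n) A) \<longlonglongrightarrow> T))"

definition op_powr :: "('a::chilbert \<Rightarrow>\<^sub>L 'a) \<Rightarrow> real \<Rightarrow> ('a \<Rightarrow>\<^sub>L 'a)" where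
  "op_powr A r = fun_calc (\<lambda>t. t powr r) A"

definition geometric_mean ::
    "real \<Rightarrow> ('a::chilbert \<Rightarrow>\<^sub>L 'a) \<Rightarrow> ('a \<Rightarrow>\<^sub>L 'a) \<Rightarrow> ('a \<Rightarrow>\<^sub>L 'a)" where
  "geometric_mean p A B =
     op_powr A (1/2) o\<^sub>L op_powr (op_powr A (-1/2) o\<^sub>L B o\<^sub>L op_powr A (-1/2)) p
       o\<^sub>L op_powr A (1/2)"

definition harmonic_mean ::
    "real \<Rightarrow> ('a::chilbert \<Rightarrow>\<^sub>L 'a) \<Rightarrow> ('a \<Rightarrow>\<^sub>L 'a) \<Rightarrow> ('a \<Rightarrow>\<^sub>L 'a)" where
  "harmonic_mean p A B = op_inv ((1 - p) *\<^sub>R op_inv A + p *\<^sub>R op_inv B)"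

end

theory Submission
  imports Defs "HOL-Computational_Algebra.Fundamental_Theorem_Algebra"
begin

text \<open>
  With \<open>X = A\<^sup>-\<^sup>1\<^sup>/\<^sup>2 B A\<^sup>-\<^sup>1\<^sup>/\<^sup>2\<close>, whose spectrum lies in \<open>[u, v] \<subseteq> (0, 1]\<close>, both means have the form
  \<open>A\<^sup>1\<^sup>/\<^sup>2 f(X) A\<^sup>1\<^sup>/\<^sup>2\<close>, so the claim reduces to a scalar inequality on \<open>(0, 1]\<close>.

  The functional calculus rests on \<open>\<parallel>P(A)\<parallel> \<le> sup |P|\<close> over the real spectrum of a self-adjoint
  \<open>A\<close>. Factor a real polynomial \<open>Q\<close> without zeros on the spectrum into linear factors and
  quadratics \<open>(t - a)\<^sup>2 + b\<^sup>2\<close>: every factor is bounded below at \<open>A\<close>, hence so is \<open>Q(A)\<close>.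
  For \<open>M = \<parallel>P(A)\<parallel>\<close> the operator \<open>M\<^sup>2 - P(A)\<^sup>2\<close> is not bounded below, so
  \<open>M\<^sup>2 - P\<^sup>2\<close> has a zero on the spectrum.
\<close>

section \<open>Operators on a complex Hilbert space\<close>

text \<open>Completeness of the space carries over to the operator type, where Cauchy sequences of
  polynomials in an operator must converge.\<close>

instance chilbert \<subseteq> banach ..

text \<open>Multiplication by \<open>\<i>\<close> turns the imaginary part into a real part, so the
  real inner product determines the complex one.\<close>

lemma Im_cinner: "Im (cinner x y) = - ((\<i> *\<^sub>C x) \<bullet> (y::'a::chilbert))"
  by (simp add: inner_eq_Re_cinner cinner_scaleC_left)

text \<open>For complex-linear \<open>A\<close>, symmetry in the real inner product controls
  imaginary parts too, on replacing \<open>x\<close> by \<open>\<i> *\<^sub>C x\<close>. From here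
  on, all estimates use the real inner product.\<close>

lemma selfadjoint_iff_inner:
  "selfadjoint A \<longleftrightarrow> A \<in> bop \<and> (\<forall>x y. A x \<bullet> y = x \<bullet> A y)"
proof
  assume "selfadjoint A"
  then show "A \<in> bop \<and> (\<forall>x y. A x \<bullet> y = x \<bullet> A y)"
    by (simp add: selfadjoint_def inner_eq_Re_cinner)
next
  assume *: "A \<in> bop \<and> (\<forall>x y. A x \<bullet> y = x \<bullet> A y)"
  have "cinner (A x) y = cinner x (A y)" for x y
  proof (rule complex_eqI)
    show "Re (cinner (A x) y) = Re (cinner x (A y))"
      using * by (simp flip: inner_eq_Re_cinner)
    show "Im (cinner (A x) y) = Im (cinner x (A y))"
      using * by (simp add: Im_cinner) (metis (mono_tags, lifting) bop_def mem_Collect_eq)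
  qed
  then show "selfadjoint A"
    using * by (simp add: selfadjoint_def)
qed

lemma positive_op_iff_inner: "positive_op A \<longleftrightarrow> selfadjoint A \<and> (\<forall>x. 0 \<le> A x \<bullet> x)"
  by (simp add: positive_op_def inner_eq_Re_cinner)

lemma scaleR_scaleC_commute: "r *\<^sub>R c *\<^sub>C x = c *\<^sub>C r *\<^sub>R (x::'a::chilbert)"
  by (simp add: scaleR_scaleC scaleC_scaleC mult.commute)

text \<open>Gives meaning to the \<open>Blinfun\<close> term in \<open>spectrum_op\<close>. The
  bound is the identity \<open>norm (c *\<^sub>C x) = cmod c * norm x\<close>.\<close>

lemma bounded_linear_scaleC: "bounded_linear (\<lambda>x::'a::chilbert. c *\<^sub>C x)"
proof
  show "c *\<^sub>C (x + y) = c *\<^sub>C x + c *\<^sub>C y" for x y :: 'a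
    by (rule scaleC_add_right)
  show "c *\<^sub>C r *\<^sub>R x = r *\<^sub>R c *\<^sub>C x" for r and x :: 'a
    by (simp add: scaleR_scaleC_commute)
  have "norm (c *\<^sub>C x) = cmod c * norm x" for x :: 'a
  proof -
    have "cinner (c *\<^sub>C x) (c *\<^sub>C x) = c * cnj c * cinner x x"
      by (metis cinner_commute cinner_scaleC_left complex_cnj_mult mult.assoc)
    then have "(norm (c *\<^sub>C x))\<^sup>2 = (cmod c * norm x)\<^sup>2"
      by (simp add: power2_norm_eq_inner inner_eq_Re_cinner power_mult_distrib
          flip: complex_norm_square)
    then show ?thesis by simp
  qed
  then show "\<exists>K. \<forall>x::'a. norm (c *\<^sub>C x) \<le> norm x * K"
    by (metis mult.commute order_refl)
qed

lemma bop_id: "id_blinfun \<in> bop"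
  by (simp add: bop_def)

lemma bop_compose: "A \<in> bop \<Longrightarrow> B \<in> bop \<Longrightarrow> A o\<^sub>L B \<in> bop"
  by (simp add: bop_def)

lemma bop_add: "A \<in> bop \<Longrightarrow> B \<in> bop \<Longrightarrow> A + B \<in> bop"
  by (simp add: bop_def blinfun.add_left scaleC_add_right)

lemma bop_scaleR: "A \<in> bop \<Longrightarrow> r *\<^sub>R A \<in> bop"
  by (simp add: bop_def blinfun.scaleR_left scaleR_scaleC_commute)

lemma bop_diff: "A \<in> bop \<Longrightarrow> B \<in> bop \<Longrightarrow> A - B \<in> bop"
  using bop_add[of A "(-1) *\<^sub>R B"] bop_scaleR[of B "-1"] by simp

lemma selfadjoint_id: "selfadjoint id_blinfun"
  by (simp add: selfadjoint_iff_inner bop_id)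

lemma selfadjoint_add: "selfadjoint A \<Longrightarrow> selfadjoint B \<Longrightarrow> selfadjoint (A + B)"
  by (simp add: selfadjoint_iff_inner bop_add blinfun.add_left inner_add_left inner_add_right)

lemma selfadjoint_scaleR: "selfadjoint A \<Longrightarrow> selfadjoint (r *\<^sub>R A)"
  by (simp add: selfadjoint_iff_inner bop_scaleR blinfun.scaleR_left)

lemma selfadjoint_diff: "selfadjoint A \<Longrightarrow> selfadjoint B \<Longrightarrow> selfadjoint (A - B)"
  using selfadjoint_add[of A "(-1) *\<^sub>R B"] selfadjoint_scaleR[of B "-1"] by simp

lemma selfadjoint_compose_commute:
  assumes "selfadjoint A" "selfadjoint B" "A o\<^sub>L B = B o\<^sub>L A"
  shows "selfadjoint (A o\<^sub>L B)"
proof -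
  have "A (B x) = B (A x)" for x
    using assms(3) by (metis blinfun_apply_blinfun_compose)
  then show ?thesis
    using assms by (simp add: selfadjoint_iff_inner bop_compose)
qed

lemma selfadjoint_sandwich:
  "selfadjoint R \<Longrightarrow> selfadjoint X \<Longrightarrow> selfadjoint (R o\<^sub>L X o\<^sub>L R)"
  by (simp add: selfadjoint_iff_inner bop_compose)

text \<open>An intersection of closed conditions, one for each scalar and vector. It lets norm
  limits of polynomials in an operator stay complex-linear.\<close>

lemma closed_bop: "closed (bop :: ('a::chilbert \<Rightarrow>\<^sub>L 'a) set)"
proof -
  have *: "bop = (\<Inter>c. \<Inter>x. {A :: 'a \<Rightarrow>\<^sub>L 'a. A (c *\<^sub>C x) = c *\<^sub>C A x})"
    by (auto simp: bop_def)
  moreover have "closed {A :: 'a \<Rightarrow>\<^sub>L 'a. A (c *\<^sub>C x) = c *\<^sub>C A x}" for c x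
    by (intro closed_Collect_eq continuous_intros
        bounded_linear.continuous_on[OF bounded_linear_scaleC])
  ultimately show ?thesis unfolding * by (intro closed_INT ballI)
qed

lemma closed_selfadjoint: "closed {A :: 'a::chilbert \<Rightarrow>\<^sub>L 'a. selfadjoint A}"
proof -
  have *: "{A :: 'a \<Rightarrow>\<^sub>L 'a. selfadjoint A} = bop \<inter> (\<Inter>x. \<Inter>y. {A :: 'a \<Rightarrow>\<^sub>L 'a. A x \<bullet> y = x \<bullet> A y})"
    by (auto simp: selfadjoint_iff_inner)
  moreover have "closed {A :: 'a \<Rightarrow>\<^sub>L 'a. A x \<bullet> y = x \<bullet> A y}" for x y
    by (intro closed_Collect_eq continuous_intros)
  ultimately show ?thesis unfolding * by (intro closed_Int closed_bop closed_INT ballI)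
qed

lemma blinfun_compose_assoc: "(A o\<^sub>L B) o\<^sub>L C = A o\<^sub>L (B o\<^sub>L C)"
  by (rule blinfun_eqI) simp

lemma blinfun_compose_id [simp]: "A o\<^sub>L id_blinfun = A" "id_blinfun o\<^sub>L A = A"
  by (auto intro: blinfun_eqI)

lemma is_op_inverse_apply:
  assumes "is_op_inverse A C"
  shows "A (C x) = x" "C (A x) = x"
  using assms by (metis is_op_inverse_def blinfun_apply_blinfun_compose blinfun_apply_id_blinfun)+

text \<open>A two-sided inverse is unique by associativity, which resolves the \<open>THE\<close> in
  \<open>op_inv\<close>.\<close>

lemma op_inv_eqI:
  assumes "is_op_inverse A C"
  shows "op_inv A = C"
  unfolding op_inv_def
proof (rule the_equality[where P = "is_op_inverse A", OF assms])
  fix D assume "is_op_inverse A D"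
  then have "D = (C o\<^sub>L A) o\<^sub>L D"
    using assms by (simp add: is_op_inverse_def)
  also have "\<dots> = C"
    using \<open>is_op_inverse A D\<close> by (simp add: blinfun_compose_assoc is_op_inverse_def)
  finally show "D = C" .
qed

section \<open>Polynomials of a self-adjoint operator\<close>

text \<open>Padding with zero coefficients frees the sum from the exact degree, which
  \<open>pCons\<close> raises by one only for a nonzero tail.\<close>

lemma op_poly_eq_sum:
  "degree P \<le> n \<Longrightarrow> op_poly P A = (\<Sum>i\<le>n. coeff P i *\<^sub>R (((\<lambda>T. A o\<^sub>L T) ^^ i) id_blinfun))"
  unfolding op_poly_def
  by (intro sum.mono_neutral_left) (auto simp: coeff_eq_0)

lemma op_poly_0 [simp]: "op_poly 0 A = 0"
  by (simp add: op_poly_def)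

text \<open>Horner's recursion: it reduces the algebra of \<open>op_poly\<close> to induction over
  \<open>pCons\<close>.\<close>

lemma op_poly_pCons [simp]: "op_poly (pCons a P) A = a *\<^sub>R id_blinfun + (A o\<^sub>L op_poly P A)"
proof -
  interpret comp: bounded_bilinear "(o\<^sub>L) :: ('a \<Rightarrow>\<^sub>L 'a) \<Rightarrow> ('a \<Rightarrow>\<^sub>L 'a) \<Rightarrow> _"
    by (rule bounded_bilinear_blinfun_compose)
  have "op_poly (pCons a P) A = (\<Sum>i\<le>Suc (degree P).
      coeff (pCons a P) i *\<^sub>R (((\<lambda>T. A o\<^sub>L T) ^^ i) id_blinfun))"
    by (rule op_poly_eq_sum) (rule degree_pCons_le)
  also have "\<dots> = a *\<^sub>R id_blinfun + (A o\<^sub>L op_poly P A)"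
    by (simp add: sum.atMost_Suc_shift op_poly_def comp.sum_right comp.scaleR_right del: sum.atMost_Suc)
  finally show ?thesis .
qed

lemma op_poly_add: "op_poly (P + Q) A = op_poly P A + op_poly Q A"
  by (induction P Q rule: poly_induct2)
    (auto intro!: blinfun_eqI simp: blinfun.add_left blinfun.add_right blinfun.scaleR_left algebra_simps)

lemma op_poly_smult: "op_poly (smult c P) A = c *\<^sub>R op_poly P A"
  by (induction P)
    (auto intro!: blinfun_eqI simp: blinfun.add_left blinfun.scaleR_left blinfun.scaleR_right algebra_simps)

lemma op_poly_diff: "op_poly (P - Q) A = op_poly P A - op_poly Q A"
  using op_poly_add[of P "smult (-1) Q" A] unfolding op_poly_smult by simp

lemma op_poly_mult: "op_poly (P * Q) A = op_poly P A o\<^sub>L op_poly Q A"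
  by (induction P)
    (auto intro!: blinfun_eqI simp: op_poly_add op_poly_smult blinfun.add_left blinfun.scaleR_left)

lemma op_poly_commute: "op_poly P A o\<^sub>L op_poly Q A = op_poly Q A o\<^sub>L op_poly P A"
  by (metis op_poly_mult mult.commute)

lemma selfadjoint_op_poly:
  assumes "selfadjoint A"
  shows "selfadjoint (op_poly P A)"
proof (induction P)
  case 0
  show ?case using selfadjoint_scaleR[OF selfadjoint_id, of 0] by simp
next
  case (pCons a P)
  have "A o\<^sub>L op_poly P A = op_poly P A o\<^sub>L A"
    using op_poly_commute[of "[:0, 1:]" A P] by simp
  then show ?case
    by (auto intro!: selfadjoint_add selfadjoint_scaleR selfadjoint_id
        selfadjoint_compose_commute assms pCons)
qed

section \<open>Real spectrum, operators bounded below and coercive operators\<close>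

definition real_spectrum :: "('a::chilbert \<Rightarrow>\<^sub>L 'a) \<Rightarrow> real set" where
  "real_spectrum A = {t. complex_of_real t \<in> spectrum_op A}"

lemma real_spectrum_iff:
  "t \<in> real_spectrum A \<longleftrightarrow> \<not> (\<exists>C. is_op_inverse (A - t *\<^sub>R id_blinfun) C)"
proof -
  have "Blinfun (\<lambda>x::'a. complex_of_real t *\<^sub>C x) = t *\<^sub>R id_blinfun"
    by (rule blinfun_eqI)
      (simp add: bounded_linear_Blinfun_apply bounded_linear_scaleC blinfun.scaleR_left scaleR_scaleC)
  then show ?thesis by (simp add: real_spectrum_def spectrum_op_def)
qed

text \<open>A one-sided substitute for invertibility: it passes to products by multiplying the
  constants, and approximate null vectors refute it.\<close>

definition bounded_below :: "('a::real_normed_vector \<Rightarrow>\<^sub>L 'a) \<Rightarrow> bool" where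
  "bounded_below T \<longleftrightarrow> (\<exists>c>0. \<forall>x. c * norm x \<le> norm (T x))"

lemma bounded_below_compose:
  assumes "bounded_below S" "bounded_below T"
  shows "bounded_below (S o\<^sub>L T)"
proof -
  obtain c d where c: "c > 0" "\<And>x. c * norm x \<le> norm (S x)"
    and d: "d > 0" "\<And>x. d * norm x \<le> norm (T x)"
    using assms by (auto simp: bounded_below_def)
  have "(c * d) * norm x \<le> norm ((S o\<^sub>L T) x)" for x
    using order_trans[OF mult_left_mono[OF d(2)[of x]] c(2)[of "T x"]] c(1)
    by (simp add: mult.assoc)
  then show ?thesis using c(1) d(1) by (auto simp: bounded_below_def intro!: exI[of _ "c * d"])
qed

lemma bounded_below_is_op_inverse:
  assumes "is_op_inverse A C"
  shows "bounded_below A"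
proof -
  have *: "C (A x) = x" for x
    using assms by (metis is_op_inverse_def blinfun_apply_blinfun_compose blinfun_apply_id_blinfun)
  \<comment> \<open>Adding 1 keeps the constant positive even when \<open>C\<close> is zero, as on
    the trivial space.\<close>
  have "norm x \<le> (norm C + 1) * norm (A x)" for x
    using norm_blinfun[of C "A x"] * by (simp add: distrib_right) (smt (verit) norm_ge_zero)
  moreover have pos: "norm C + 1 > 0"
    by (simp add: add_nonneg_pos)
  ultimately have "(1 / (norm C + 1)) * norm x \<le> norm (A x)" for x
    by (simp add: pos_divide_le_eq mult.commute)
  moreover have "1 / (norm C + 1) > 0"
    using pos by simp
  ultimately show ?thesis unfolding bounded_below_def by blast
qed

text \<open>The lower bound \<open>c\<close> gives both injectivity and the bound
  \<open>1 / c\<close> for the inverse map; linearity over the complex numbers is inherited from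
  \<open>A\<close>.\<close>

lemma is_op_inverse_of_bijective:
  assumes "A \<in> bop" "bounded_below A" "surj A"
  shows "\<exists>C. is_op_inverse A C"
proof -
  obtain c where c: "c > 0" "\<And>x. c * norm x \<le> norm (A x)"
    using assms(2) by (auto simp: bounded_below_def)
  have inj: "inj A"
  proof (rule injI)
    fix x y assume "A x = A y"
    then have "c * norm (x - y) \<le> 0" using c(2)[of "x - y"] by (simp add: blinfun.diff_right)
    then show "x = y" using c(1) by (simp add: mult_le_0_iff)
  qed
  define g where "g = inv A"
  have Ag: "A (g y) = y" for y using assms(3) by (simp add: g_def surj_f_inv_f)
  have gA: "g (A x) = x" for x using inj by (simp add: g_def)
  have AC: "A (s *\<^sub>C x) = s *\<^sub>C A x" for s x using assms(1) by (simp add: bop_def)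
  have bl: "bounded_linear g"
  proof
    show "g (x + y) = g x + g y" for x y
      by (metis Ag gA blinfun.add_right)
    show "g (r *\<^sub>R x) = r *\<^sub>R g x" for r x
      by (metis Ag gA blinfun.scaleR_right)
    have "norm (g y) \<le> norm y * (1 / c)" for y
      using c(2)[of "g y"] c(1) by (simp add: Ag field_simps)
    then show "\<exists>K. \<forall>x. norm (g x) \<le> norm x * K" by blast
  qed
  have "is_op_inverse A (Blinfun g)"
    unfolding is_op_inverse_def bop_def
  proof (intro conjI CollectI allI blinfun_eqI)
    show "Blinfun g (s *\<^sub>C x) = s *\<^sub>C Blinfun g x" for s x
      unfolding bounded_linear_Blinfun_apply[OF bl] by (metis Ag gA AC)
  qed (simp_all add: bounded_linear_Blinfun_apply[OF bl] Ag gA)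
  then show ?thesis by blast
qed

text \<open>Cauchy-Schwarz bounds the quadratic form by \<open>norm (S x) * norm x\<close>; one
  factor \<open>norm x\<close> cancels.\<close>

lemma coercive_bounded_below:
  fixes S :: "'a::real_inner \<Rightarrow>\<^sub>L 'a"
  assumes "d > 0" "\<And>x. d * (x \<bullet> x) \<le> S x \<bullet> x"
  shows "bounded_below S"
proof -
  have "d * norm x \<le> norm (S x)" for x
  proof (cases "x = 0")
    case False
    have "(d * norm x) * norm x \<le> norm (S x) * norm x"
      using assms(2)[of x] norm_cauchy_schwarz[of "S x" x]
      by (simp add: dot_square_norm power2_eq_square)
    then show ?thesis using False by simp
  qed simp
  then show ?thesis using assms(1) by (auto simp: bounded_below_def)
qed

text \<open>Lax--Milgram: for small \<open>r\<close> the map \<open>x \<mapsto> x - r (S x - y)\<close> is a contraction.\<close>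
lemma coercive_invertible:
  fixes S :: "'a::chilbert \<Rightarrow>\<^sub>L 'a"
  assumes S: "S \<in> bop" and d: "d > 0" "\<And>x. d * (x \<bullet> x) \<le> S x \<bullet> x"
  shows "\<exists>C. is_op_inverse S C"
proof (rule is_op_inverse_of_bijective[OF S])
  show "bounded_below S" using d by (rule coercive_bounded_below)
  \<comment> \<open>Adding \<open>d\<close> to the norm ensures \<open>M > 0\<close> and
    \<open>d \<le> M\<close>, so that the squared contraction factor below is nonnegative.\<close>
  define M where "M = norm S + d"
  have M: "M > 0" "d \<le> M" "norm S \<le> M" using d(1) by (auto simp: M_def add_nonneg_pos)
  \<comment> \<open>This value minimises \<open>1 - 2 * r * d + r\<^sup>2 * M\<^sup>2\<close>, the
    squared contraction factor; the minimum is \<open>1 - d\<^sup>2 / M\<^sup>2\<close>.\<close>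
  define r where "r = d / M\<^sup>2"
  have r: "r > 0" using M d by (simp add: r_def)
  have contr: "(norm (x - r *\<^sub>R S x))\<^sup>2 \<le> (1 - d\<^sup>2 / M\<^sup>2) * (norm x)\<^sup>2" for x
  proof -
    have 1: "(norm (S x))\<^sup>2 \<le> (M * norm x)\<^sup>2"
      by (intro power_mono order_trans[OF norm_blinfun] mult_right_mono M) auto
    have "(norm (x - r *\<^sub>R S x))\<^sup>2 = (norm x)\<^sup>2 - 2 * r * (S x \<bullet> x) + r\<^sup>2 * (norm (S x))\<^sup>2"
      unfolding power2_norm_eq_inner
      by (simp add: inner_diff_left inner_diff_right inner_commute power2_eq_square algebra_simps)
    also have "\<dots> \<le> (norm x)\<^sup>2 - 2 * r * (d * (norm x)\<^sup>2) + r\<^sup>2 * (M * norm x)\<^sup>2"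
      using d(2)[of x] r 1
      by (intro add_mono diff_mono mult_left_mono) (auto simp: power2_norm_eq_inner)
    also have "\<dots> = (1 - d\<^sup>2 / M\<^sup>2) * (norm x)\<^sup>2"
      using M(1) by (simp add: r_def power2_eq_square field_simps)
    finally show ?thesis .
  qed
  define k where "k = sqrt (1 - d\<^sup>2 / M\<^sup>2)"
  have dM: "d\<^sup>2 / M\<^sup>2 \<le> 1" "d\<^sup>2 / M\<^sup>2 > 0" using M d(1) by (auto simp: power_mono)
  have k: "0 \<le> k" "k < 1" using dM by (auto simp: k_def)
  have contr': "norm (x - r *\<^sub>R S x) \<le> k * norm x" for x
    using real_sqrt_le_mono[OF contr[of x]] by (simp add: k_def real_sqrt_mult)
  show "surj S"
  proof (rule surjI)
    fix y
    define f where "f x = x - r *\<^sub>R (S x - y)" for x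
    have "dist (f a) (f b) \<le> k * dist a b" for a b
      using contr'[of "a - b"] by (simp add: f_def dist_norm blinfun.diff_right algebra_simps)
    then have "\<exists>!x. f x = x" using banach_fix_type[OF k, of f] by blast
    then obtain x where "f x = x" by blast
    then have "S x = y" using r by (simp add: f_def)
    then show "S (SOME x. S x = y) = y" by (rule someI)
  qed
qed

section \<open>Bounding a polynomial of an operator by its values on the real spectrum\<close>

lemma poly_map_poly_of_real:
  "poly (map_poly of_real P) (of_real x) = (of_real (poly P x) :: 'a::real_field)"
  by (induction P) (simp_all add: map_poly_pCons)

text \<open>The quadratic is the product of the linear factors for \<open>z\<close> and its
  conjugate. Division leaves a real remainder of degree at most 1 that vanishes at the nonreal
  \<open>z\<close>, hence is zero.\<close>

lemma real_poly_eq_mult_nonreal_root: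
  fixes P :: "real poly"
  assumes root: "poly (map_poly of_real P) z = (0::complex)" and z: "Im z \<noteq> 0"
  shows "\<exists>Q. P = [:(Re z)\<^sup>2 + (Im z)\<^sup>2, - 2 * Re z, 1:] * Q"
proof -
  define D where "D = [:(Re z)\<^sup>2 + (Im z)\<^sup>2, - 2 * Re z, 1:]"
  define R where "R = P mod D"
  have D: "poly (map_poly of_real D) z = 0"
    by (simp add: D_def map_poly_pCons complex_eq_iff power2_eq_square algebra_simps)
  have "P = D * (P div D) + R" by (simp add: R_def)
  then have "map_poly of_real P = map_poly of_real (D * (P div D) + R)" by simp
  also have "\<dots> = map_poly of_real D * map_poly of_real (P div D) + (map_poly of_real R :: complex poly)"
    by (simp add: poly_eq_iff coeff_map_poly coeff_mult)
  finally have "map_poly of_real P = map_poly of_real D * map_poly of_real (P div D) + (map_poly of_real R :: complex poly)" .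
  then have "poly (map_poly of_real R) z = 0" using root D by simp
  moreover have "degree R < 2"
    using degree_mod_less[of D P] by (auto simp: R_def D_def)
  then obtain a b where ab: "R = [:a, b:]"
    by (metis degree1_coeffs degree_eq_zeroE less_2_cases One_nat_def pCons_0_0)
  ultimately have "a + b * Re z = 0" "b * Im z = 0"
    by (simp_all add: map_poly_pCons complex_eq_iff algebra_simps split: if_splits)
  then have "R = 0" using z ab by simp
  then have "P = D * (P div D)" using \<open>P = D * (P div D) + R\<close> by simp
  then show ?thesis unfolding D_def by blast
qed

text \<open>The assumption \<open>P \<noteq> 0\<close> matters when the real spectrum is empty; its
  nonemptiness on a nontrivial space is derived from this lemma later.\<close>

lemma op_poly_bounded_below:
  fixes A :: "'a::chilbert \<Rightarrow>\<^sub>L 'a"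
  assumes A: "selfadjoint A"
  shows "P \<noteq> 0 \<Longrightarrow> (\<And>t. t \<in> real_spectrum A \<Longrightarrow> poly P t \<noteq> 0) \<Longrightarrow> bounded_below (op_poly P A)"
proof (induction "degree P" arbitrary: P rule: less_induct)
  case less
  \<comment> \<open>The fundamental theorem of algebra gives a complex root of a nonconstant
    \<open>P\<close>; if its imaginary part is zero, its real part is a root of \<open>P\<close>
    itself.\<close>
  consider (const) "degree P = 0" | (real) t where "poly P t = 0"
    | (complex) z where "poly (map_poly of_real P) z = (0::complex)" "Im z \<noteq> 0"
  proof -
    have "\<exists>z. poly (map_poly of_real P) z = (0::complex)" if "degree P \<noteq> 0"
      using that by (intro fundamental_theorem_of_algebra) (simp add: constant_degree degree_map_poly)
    moreover have "poly P (Re z) = 0" if "poly (map_poly of_real P) z = (0::complex)" "Im z = 0" for z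
    proof -
      have "z = of_real (Re z)" using that(2) by (simp add: complex_eq_iff)
      then have "of_real (poly P (Re z)) = (0::complex)"
        using that(1) by (metis poly_map_poly_of_real)
      then show ?thesis by simp
    qed
    ultimately show ?thesis using const real complex by blast
  qed
  then show ?case
  proof cases
    case const
    then obtain c where c: "P = [:c:]" by (auto elim!: degree_eq_zeroE)
    then show ?thesis using less.prems(1)
      by (auto simp: bounded_below_def blinfun.scaleR_left intro!: exI[of _ "\<bar>c\<bar>"])
  next
    case real
    then obtain Q where Q: "P = [:-t, 1:] * Q" by (auto simp: poly_eq_0_iff_dvd)
    have "Q \<noteq> 0" using less.prems(1) Q by auto
    then have "degree P = Suc (degree Q)" unfolding Q by (subst degree_mult_eq) auto
    moreover have "poly Q s \<noteq> 0" if "s \<in> real_spectrum A" for s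
      using less.prems(2)[OF that] Q by auto
    ultimately have "bounded_below (op_poly Q A)" using less.hyps \<open>Q \<noteq> 0\<close> by simp
    moreover have "t \<notin> real_spectrum A" using less.prems(2) real by blast
    then have "bounded_below (A - t *\<^sub>R id_blinfun)"
      using bounded_below_is_op_inverse by (auto simp: real_spectrum_iff)
    moreover have "op_poly [:-t, 1:] A = A - t *\<^sub>R id_blinfun"
      by simp
    ultimately show ?thesis unfolding Q op_poly_mult by (metis bounded_below_compose)
  next
    case complex
    define a b where "a = Re z" and "b = Im z"
    define D where "D = [:a\<^sup>2 + b\<^sup>2, - 2 * a, 1:]"
    obtain Q where Q: "P = D * Q"
      using real_poly_eq_mult_nonreal_root[OF complex] unfolding D_def a_def b_def by blast
    have "Q \<noteq> 0" using less.prems(1) Q by auto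
    moreover have "D \<noteq> 0" "degree D = 2" by (auto simp: D_def)
    ultimately have "degree P = 2 + degree Q" unfolding Q by (subst degree_mult_eq) auto
    moreover have "poly Q s \<noteq> 0" if "s \<in> real_spectrum A" for s
      using less.prems(2)[OF that] Q by auto
    ultimately have "bounded_below (op_poly Q A)" using less.hyps \<open>Q \<noteq> 0\<close> by simp
    moreover have "bounded_below (op_poly D A)"
    \<comment> \<open>Completing the square gives \<open>D(A) = (A - a)\<^sup>2 + b\<^sup>2\<close>,
      and the square of the self-adjoint \<open>A - a\<close> has a nonnegative quadratic
      form.\<close>
    proof (rule coercive_bounded_below)
      show "b\<^sup>2 > 0" using complex by (simp add: b_def)
      show "b\<^sup>2 * (x \<bullet> x) \<le> op_poly D A x \<bullet> x" for x
      proof -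
        have sym: "A u \<bullet> w = u \<bullet> A w" for u w using A by (simp add: selfadjoint_iff_inner)
        have eq: "op_poly D A x = (a\<^sup>2 + b\<^sup>2) *\<^sub>R x - (2 * a) *\<^sub>R A x + A (A x)"
          by (simp add: D_def blinfun.add_left blinfun.add_right blinfun.scaleR_left
              blinfun.scaleR_right blinfun.diff_left blinfun.diff_right)
        have "op_poly D A x \<bullet> x - b\<^sup>2 * (x \<bullet> x) = (A x - a *\<^sub>R x) \<bullet> (A x - a *\<^sub>R x)"
          unfolding eq
          by (simp add: inner_diff_left inner_diff_right inner_add_left sym power2_eq_square
              algebra_simps)
        then show ?thesis using inner_ge_zero[of "A x - a *\<^sub>R x"] by linarith
      qed
    qed
    ultimately show ?thesis unfolding Q op_poly_mult by (metis bounded_below_compose)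
  qed
qed

text \<open>A nearly norm-attaining unit vector of a self-adjoint \<open>T\<close> is nearly annihilated by
  \<open>\<parallel>T\<parallel>\<^sup>2 - T\<^sup>2\<close>.\<close>
lemma norm_square_diff_not_bounded_below:
  fixes T :: "'a::chilbert \<Rightarrow>\<^sub>L 'a"
  assumes T: "selfadjoint T" and ne: "\<exists>x::'a. x \<noteq> 0"
  shows "\<not> bounded_below ((norm T)\<^sup>2 *\<^sub>R id_blinfun - (T o\<^sub>L T))"
proof
  assume "bounded_below ((norm T)\<^sup>2 *\<^sub>R id_blinfun - (T o\<^sub>L T))"
  then obtain c where c: "c > 0" "\<And>x. c * norm x \<le> norm ((norm T)\<^sup>2 *\<^sub>R x - T (T x))"
    by (auto simp: bounded_below_def blinfun.diff_left blinfun.scaleR_left)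
  have sym: "T u \<bullet> w = u \<bullet> T w" for u w using T by (simp add: selfadjoint_iff_inner)
  define M where "M = norm T"
  have M0: "M \<ge> 0" by (simp add: M_def)
  have key: "(c * norm x)\<^sup>2 \<le> M\<^sup>2 * (M\<^sup>2 * (norm x)\<^sup>2 - (norm (T x))\<^sup>2)" for x
  proof -
    have "(c * norm x)\<^sup>2 \<le> (norm (M\<^sup>2 *\<^sub>R x - T (T x)))\<^sup>2"
      using c unfolding M_def by (intro power_mono) auto
    also have "\<dots> = M^4 * (norm x)\<^sup>2 - 2 * M\<^sup>2 * (norm (T x))\<^sup>2 + (norm (T (T x)))\<^sup>2"
      unfolding power2_norm_eq_inner
      by (simp add: inner_diff_left inner_diff_right sym power4_eq_xxxx power2_eq_square
          algebra_simps)
    also have "\<dots> \<le> M^4 * (norm x)\<^sup>2 - 2 * M\<^sup>2 * (norm (T x))\<^sup>2 + (M * norm (T x))\<^sup>2"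
      using norm_blinfun[of T "T x"] by (simp add: M_def power_mono)
    also have "\<dots> = M\<^sup>2 * (M\<^sup>2 * (norm x)\<^sup>2 - (norm (T x))\<^sup>2)"
      by (simp add: algebra_simps power2_eq_square power4_eq_xxxx)
    finally show ?thesis .
  qed
  \<comment> \<open>For \<open>M = 0\<close>, \<open>key\<close> would force
    \<open>c * norm x = 0\<close> for every \<open>x\<close>.\<close>
  have "M \<noteq> 0"
    using key ne c(1) by (metis mult_eq_0_iff power_zero_numeral norm_eq_zero not_le
        zero_less_power2 less_irrefl mult_zero_left)
  then have M: "M > 0" using M0 by simp
  \<comment> \<open>Dividing \<open>key\<close> by \<open>M\<^sup>2\<close> bounds the norm of
    \<open>T\<close> by \<open>k\<close>, which is smaller than \<open>M\<close>. The
    \<open>max\<close> keeps the radicand nonnegative; if it takes effect, then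
    \<open>k = 0 < M\<close>.\<close>
  define k where "k = sqrt (max 0 (M\<^sup>2 - (c / M)\<^sup>2))"
  have "norm (T x) \<le> k * norm x" for x
  proof -
    have "(norm (T x))\<^sup>2 \<le> (M\<^sup>2 - (c / M)\<^sup>2) * (norm x)\<^sup>2"
    proof -
      have "(c * norm x)\<^sup>2 / M\<^sup>2 \<le> M\<^sup>2 * (norm x)\<^sup>2 - (norm (T x))\<^sup>2"
        using key[of x] M by (simp add: pos_divide_le_eq mult.commute)
      then show ?thesis by (simp add: power_mult_distrib power_divide left_diff_distrib)
    qed
    also have "\<dots> \<le> (max 0 (M\<^sup>2 - (c / M)\<^sup>2)) * (norm x)\<^sup>2"
      by (intro mult_right_mono) auto
    finally have "sqrt ((norm (T x))\<^sup>2) \<le> sqrt ((max 0 (M\<^sup>2 - (c / M)\<^sup>2)) * (norm x)\<^sup>2)"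
      by (rule real_sqrt_le_mono)
    then show ?thesis by (simp add: k_def real_sqrt_mult)
  qed
  then have "M \<le> k" unfolding M_def
    by (intro norm_blinfun_bound) (auto simp: k_def)
  then have "M\<^sup>2 \<le> k\<^sup>2" using M by (intro power_mono) auto
  also have "k\<^sup>2 = max 0 (M\<^sup>2 - (c / M)\<^sup>2)" by (simp add: k_def)
  finally show False using M c(1) by (simp add: max_def split: if_splits)
qed

text \<open>With empty real spectrum, the polynomial \<open>(norm A)\<^sup>2 - t\<^sup>2\<close>
  would have no zero there, making the operator of the previous lemma bounded below.\<close>

lemma real_spectrum_nonempty:
  fixes A :: "'a::chilbert \<Rightarrow>\<^sub>L 'a"
  assumes A: "selfadjoint A" and ne: "\<exists>x::'a. x \<noteq> 0"
  shows "real_spectrum A \<noteq> {}"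
proof
  assume "real_spectrum A = {}"
  then have "bounded_below (op_poly [:(norm A)\<^sup>2, 0, -1:] A)"
    by (intro op_poly_bounded_below A) auto
  moreover have "op_poly [:(norm A)\<^sup>2, 0, -1:] A = (norm A)\<^sup>2 *\<^sub>R id_blinfun - (A o\<^sub>L A)"
    by (auto intro!: blinfun_eqI simp: blinfun.diff_left blinfun.add_left blinfun.scaleR_left
        blinfun.minus_left blinfun.minus_right)
  ultimately show False using norm_square_diff_not_bounded_below[OF A ne] by simp
qed

lemma norm_op_poly_le:
  fixes A :: "'a::chilbert \<Rightarrow>\<^sub>L 'a"
  assumes A: "selfadjoint A" and e: "e \<ge> 0" and P: "\<And>t. t \<in> real_spectrum A \<Longrightarrow> \<bar>poly P t\<bar> \<le> e"
  shows "norm (op_poly P A) \<le> e"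
proof (cases "\<exists>x::'a. x \<noteq> 0")
  case False
  then have "op_poly P A = 0" by (intro blinfun_eqI) metis
  then show ?thesis using e by simp
next
  case ne: True
  define M where "M = norm (op_poly P A)"
  have op: "op_poly ([:M\<^sup>2:] - P * P) A = M\<^sup>2 *\<^sub>R id_blinfun - (op_poly P A o\<^sub>L op_poly P A)"
    by (simp add: op_poly_diff op_poly_mult)
  have "\<exists>t \<in> real_spectrum A. poly ([:M\<^sup>2:] - P * P) t = 0"
  \<comment> \<open>If the difference is the zero polynomial, any spectral point is a zero; this is
    where nonemptiness of the spectrum enters.\<close>
  proof (cases "[:M\<^sup>2:] - P * P = 0")
    case True
    then show ?thesis using real_spectrum_nonempty[OF A ne] by auto
  next
    case False
    then show ?thesis
      using op_poly_bounded_below[OF A False]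
        norm_square_diff_not_bounded_below[OF selfadjoint_op_poly[OF A] ne, of P]
      unfolding op[unfolded M_def] M_def by blast
  qed
  then obtain t where t: "t \<in> real_spectrum A" "M\<^sup>2 = (poly P t)\<^sup>2"
    by (auto simp: power2_eq_square)
  then have "M = \<bar>poly P t\<bar>"
    by (metis M_def norm_ge_zero abs_of_nonneg real_sqrt_abs)
  then show ?thesis using P[OF t(1)] by (simp add: M_def)
qed

section \<open>Bounds from the quadratic form\<close>

lemma real_spectrum_subset:
  fixes A :: "'a::chilbert \<Rightarrow>\<^sub>L 'a"
  assumes A: "A \<in> bop"
    and a: "\<And>x. a * (x \<bullet> x) \<le> A x \<bullet> x" and b: "\<And>x. A x \<bullet> x \<le> b * (x \<bullet> x)"
  shows "real_spectrum A \<subseteq> {a..b}"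
proof
  fix t assume t: "t \<in> real_spectrum A"
  show "t \<in> {a..b}"
  proof (rule ccontr)
    assume "t \<notin> {a..b}"
    \<comment> \<open>To the left of the interval \<open>A - t\<close> is coercive, to the right
      \<open>t - A\<close> is; the second inverse is then negated.\<close>
    then consider "t < a" | "t > b" by fastforce
    then have "\<exists>C. is_op_inverse (A - t *\<^sub>R id_blinfun) C"
    proof cases
      case 1
      show ?thesis
      proof (rule coercive_invertible)
        show "a - t > 0" using 1 by simp
        show "(a - t) * (x \<bullet> x) \<le> (A - t *\<^sub>R id_blinfun) x \<bullet> x" for x
          using a[of x] by (simp add: blinfun.diff_left blinfun.scaleR_left inner_diff_left algebra_simps)
      qed (intro bop_diff bop_scaleR bop_id A)
    next
      case 2
      have "\<exists>C. is_op_inverse (t *\<^sub>R id_blinfun - A) C"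
      proof (rule coercive_invertible)
        show "t - b > 0" using 2 by simp
        show "(t - b) * (x \<bullet> x) \<le> (t *\<^sub>R id_blinfun - A) x \<bullet> x" for x
          using b[of x] by (simp add: blinfun.diff_left blinfun.scaleR_left inner_diff_left algebra_simps)
      qed (intro bop_diff bop_scaleR bop_id A)
      then obtain C where C: "is_op_inverse (t *\<^sub>R id_blinfun - A) C" by blast
      have "is_op_inverse (A - t *\<^sub>R id_blinfun) ((-1) *\<^sub>R C)"
        unfolding is_op_inverse_def
      proof (intro conjI bop_scaleR blinfun_eqI)
        show "C \<in> bop" using C by (simp add: is_op_inverse_def)
        have C1: "t *\<^sub>R C x - A (C x) = x" for x
          using is_op_inverse_apply(1)[OF C, of x]
          by (simp add: blinfun.diff_left blinfun.scaleR_left)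
        have C2: "t *\<^sub>R C x - C (A x) = x" for x
          using is_op_inverse_apply(2)[OF C, of x]
          by (simp add: blinfun.diff_left blinfun.diff_right blinfun.scaleR_left blinfun.scaleR_right)
        show "((A - t *\<^sub>R id_blinfun) o\<^sub>L ((-1) *\<^sub>R C)) x = id_blinfun x" for x
          using C1[of x] by (simp add: blinfun.diff_left blinfun.minus_left blinfun.minus_right blinfun.scaleR_left)
        show "(((-1) *\<^sub>R C) o\<^sub>L (A - t *\<^sub>R id_blinfun)) x = id_blinfun x" for x
          using C2[of x] by (simp add: blinfun.diff_left blinfun.minus_left blinfun.diff_right blinfun.scaleR_left blinfun.scaleR_right)
      qed
      then show ?thesis by blast
    qed
    then show False using t by (simp add: real_spectrum_iff)
  qed
qed

text \<open>Positivity of the form at \<open>x - (1/M) *\<^sub>R A x\<close> yields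
  \<open>(norm (A x))\<^sup>2 / M \<le> A x \<bullet> x\<close>. Invertibility bounds the left side
  below by a multiple of \<open>x \<bullet> x\<close>.\<close>

lemma strictly_positive_bounds:
  fixes A :: "'a::chilbert \<Rightarrow>\<^sub>L 'a"
  assumes "strictly_positive A"
  shows "\<exists>a>0. \<forall>x. a * (x \<bullet> x) \<le> A x \<bullet> x"
proof -
  have sym: "A u \<bullet> w = u \<bullet> A w" and pos: "0 \<le> A u \<bullet> u" for u w
    using assms by (auto simp: strictly_positive_def positive_op_iff_inner selfadjoint_iff_inner)
  obtain c where c: "c > 0" "\<And>x. c * norm x \<le> norm (A x)"
    using assms bounded_below_is_op_inverse unfolding strictly_positive_def bounded_below_def by metis
  define M where "M = norm A + 1"
  have M: "M > 0" "norm A \<le> M" by (auto simp: M_def add_nonneg_pos)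
  have "(c\<^sup>2 / M) * (x \<bullet> x) \<le> A x \<bullet> x" for x
  proof -
    have "A (A x) \<bullet> A x \<le> norm (A (A x)) * norm (A x)" by (rule norm_cauchy_schwarz)
    also have "\<dots> \<le> (M * norm (A x)) * norm (A x)"
      by (intro mult_right_mono order_trans[OF norm_blinfun] M) auto
    finally have 1: "A (A x) \<bullet> A x \<le> M * (A x \<bullet> A x)"
      unfolding dot_square_norm power2_eq_square by (simp only: mult.assoc)
    have "0 \<le> A (x - (1/M) *\<^sub>R A x) \<bullet> (x - (1/M) *\<^sub>R A x)" by (rule pos)
    also have "\<dots> = A x \<bullet> x - 2 / M * (A x \<bullet> A x) + (1/M)\<^sup>2 * (A (A x) \<bullet> A x)"
      by (simp add: blinfun.diff_right blinfun.scaleR_right inner_diff_left inner_diff_right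
          sym[of "A x" x] power2_eq_square algebra_simps)
    also have "\<dots> \<le> A x \<bullet> x - 2 / M * (A x \<bullet> A x) + (1/M)\<^sup>2 * (M * (A x \<bullet> A x))"
      using 1 by (intro add_left_mono mult_left_mono) auto
    also have "\<dots> = A x \<bullet> x - (norm (A x))\<^sup>2 / M"
      using M unfolding power2_norm_eq_inner by (simp add: power2_eq_square field_simps)
    finally have "(norm (A x))\<^sup>2 / M \<le> A x \<bullet> x" by simp
    moreover have "(c * norm x)\<^sup>2 / M \<le> (norm (A x))\<^sup>2 / M"
      using c M by (intro divide_right_mono power_mono) auto
    ultimately show ?thesis by (simp add: power_mult_distrib power2_norm_eq_inner)
  qed
  moreover have "c\<^sup>2 / M > 0" using c M by simp
  ultimately show ?thesis by blast
qed

lemma inner_le_norm_blinfun: "A x \<bullet> x \<le> norm A * (x \<bullet> x)"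
  for A :: "'a::real_inner \<Rightarrow>\<^sub>L 'a"
proof -
  have "A x \<bullet> x \<le> norm (A x) * norm x" by (rule norm_cauchy_schwarz)
  also have "\<dots> \<le> (norm A * norm x) * norm x" by (intro mult_right_mono norm_blinfun) auto
  finally show ?thesis by (simp add: dot_square_norm power2_eq_square)
qed

section \<open>Continuous functional calculus\<close>

lemma uniform_polynomial_approximation:
  fixes f :: "real \<Rightarrow> real"
  assumes f: "continuous_on {a..b} f"
  obtains P where "uniform_limit {a..b} (\<lambda>n. poly (P n)) f sequentially"
proof -
  have "\<exists>P. \<forall>x\<in>{a..b}. \<bar>f x - poly P x\<bar> < 1 / Suc n" for n
  proof -
    obtain g where g: "real_polynomial_function g" "\<And>x. x \<in> {a..b} \<Longrightarrow> \<bar>f x - g x\<bar> < 1 / Suc n"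
      using Stone_Weierstrass_real_polynomial_function[OF compact_Icc f, of "1 / Suc n"] by auto
    then obtain c k where "g = (\<lambda>x. \<Sum>i\<le>k. c i * x ^ i)"
      by (auto simp: real_polynomial_function_iff_sum)
    then have "g = poly (\<Sum>i\<le>k. monom (c i) i)" by (simp add: fun_eq_iff poly_sum poly_monom)
    then show ?thesis using g by blast
  qed
  then obtain P where P: "\<And>n x. x \<in> {a..b} \<Longrightarrow> \<bar>f x - poly (P n) x\<bar> < 1 / Suc n" by metis
  have "uniform_limit {a..b} (\<lambda>n. poly (P n)) f sequentially"
  proof (rule uniform_limitI)
    fix e :: real assume "e > 0"
    then have "\<forall>\<^sub>F n in sequentially. 1 / real (Suc n) < e"
      using LIMSEQ_inverse_real_of_nat by (auto simp: inverse_eq_divide dest: order_tendstoD(2))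
    then show "\<forall>\<^sub>F n in sequentially. \<forall>x\<in>{a..b}. dist (poly (P n) x) (f x) < e"
    proof eventually_elim
      case (elim n)
      then show ?case using P[of _ n] by (fastforce simp: dist_real_def abs_minus_commute)
    qed
  qed
  then show thesis by (rule that)
qed

text \<open>Independence of the approximating sequence: the norm bound is applied to
  \<open>P n - Q n\<close>, which is uniformly small on the spectrum.\<close>

lemma op_poly_diff_tendsto_0:
  assumes A: "selfadjoint A"
    and P: "uniform_limit (real_spectrum A) (\<lambda>n. poly (P n)) f sequentially"
    and Q: "uniform_limit (real_spectrum A) (\<lambda>n. poly (Q n)) f sequentially"
  shows "(\<lambda>n. op_poly (P n) A - op_poly (Q n) A) \<longlonglongrightarrow> 0"
proof (rule tendstoI)
  fix e :: real assume e: "e > 0"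
  have "\<forall>\<^sub>F n in sequentially. \<forall>x\<in>real_spectrum A. dist (poly (P n) x) (f x) < e/4"
    "\<forall>\<^sub>F n in sequentially. \<forall>x\<in>real_spectrum A. dist (poly (Q n) x) (f x) < e/4"
    using e uniform_limitD[OF P, of "e/4"] uniform_limitD[OF Q, of "e/4"] by simp_all
  then show "\<forall>\<^sub>F n in sequentially. dist (op_poly (P n) A - op_poly (Q n) A) 0 < e"
  proof eventually_elim
    case (elim n)
    have "norm (op_poly (P n - Q n) A) \<le> e/2"
    proof (rule norm_op_poly_le[OF A])
      fix t assume "t \<in> real_spectrum A"
      then have "dist (poly (P n) t) (f t) < e/4" "dist (poly (Q n) t) (f t) < e/4"
        using elim by auto
      then show "\<bar>poly (P n - Q n) t\<bar> \<le> e/2"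
        unfolding dist_real_def poly_diff by linarith
    qed (use e in simp)
    then show ?case using e by (simp add: op_poly_diff)
  qed
qed

lemma op_poly_convergent:
  assumes A: "selfadjoint A"
    and P: "uniform_limit (real_spectrum A) (\<lambda>n. poly (P n)) f sequentially"
  shows "convergent (\<lambda>n. op_poly (P n) A)"
proof (rule Cauchy_convergent, rule metric_CauchyI)
  fix e :: real assume e: "e > 0"
  have "uniformly_Cauchy_on (real_spectrum A) (\<lambda>n. poly (P n))"
    using P by (intro uniformly_convergent_Cauchy) (auto simp: uniformly_convergent_on_def)
  then obtain M where M: "\<And>x m n. x \<in> real_spectrum A \<Longrightarrow> M \<le> m \<Longrightarrow> M \<le> n \<Longrightarrow>
      dist (poly (P m) x) (poly (P n) x) < e/2"
    using e unfolding uniformly_Cauchy_on_def by (meson half_gt_zero)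
  have "dist (op_poly (P m) A) (op_poly (P n) A) < e" if "M \<le> m" "M \<le> n" for m n
  proof -
    have "norm (op_poly (P m - P n) A) \<le> e/2"
      by (rule norm_op_poly_le[OF A])
        (use e M[OF _ that] in \<open>auto simp: dist_real_def intro: less_imp_le\<close>)
    then show ?thesis using e by (simp add: op_poly_diff dist_norm)
  qed
  then show "\<exists>M. \<forall>m\<ge>M. \<forall>n\<ge>M. dist (op_poly (P m) A) (op_poly (P n) A) < e" by blast
qed

text \<open>Resolves the \<open>THE\<close> in \<open>fun_calc\<close>: one sequence converges by
  the Cauchy criterion, and every other one has the same limit. An interval around the spectrum is
  used because polynomial approximation is available there.\<close>

lemma fun_calc_limit:
  assumes A: "selfadjoint A" and ab: "real_spectrum A \<subseteq> {a..b}" and f: "continuous_on {a..b} f"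
    and P: "uniform_limit {a..b} (\<lambda>n. poly (P n)) f sequentially"
  shows "(\<lambda>n. op_poly (P n) A) \<longlonglongrightarrow> fun_calc f A"
proof -
  note P' = uniform_limit_on_subset[OF P ab]
  obtain T where T: "(\<lambda>n. op_poly (P n) A) \<longlonglongrightarrow> T"
    using op_poly_convergent[OF A P'] by (auto simp: convergent_def)
  have "fun_calc f A = T"
    unfolding fun_calc_def real_spectrum_def[symmetric]
  proof (rule the_equality)
    show "T \<in> bop \<and> (\<forall>Q. uniform_limit (real_spectrum A) (\<lambda>n. poly (Q n)) f sequentially
        \<longrightarrow> (\<lambda>n. op_poly (Q n) A) \<longlonglongrightarrow> T)"
    proof (intro conjI allI impI)
      show "T \<in> bop"
        using selfadjoint_op_poly[OF A]
        by (intro closed_sequentially[OF closed_bop _ T]) (auto simp: selfadjoint_def)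
      fix Q assume "uniform_limit (real_spectrum A) (\<lambda>n. poly (Q n)) f sequentially"
      from tendsto_diff[OF T op_poly_diff_tendsto_0[OF A P' this]]
      show "(\<lambda>n. op_poly (Q n) A) \<longlonglongrightarrow> T" by simp
    qed
    fix T' assume "T' \<in> bop \<and> (\<forall>Q. uniform_limit (real_spectrum A) (\<lambda>n. poly (Q n)) f sequentially
        \<longrightarrow> (\<lambda>n. op_poly (Q n) A) \<longlonglongrightarrow> T')"
    then have "(\<lambda>n. op_poly (P n) A) \<longlonglongrightarrow> T'" using P' by blast
    then show "T' = T" using T LIMSEQ_unique by blast
  qed
  then show ?thesis using T by simp
qed

section \<open>Algebra and order in the functional calculus\<close>

context
  fixes A :: "'a::chilbert \<Rightarrow>\<^sub>L 'a" and a b :: real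
  assumes A: "selfadjoint A" and ab: "real_spectrum A \<subseteq> {a..b}"
begin

lemma selfadjoint_fun_calc:
  assumes "continuous_on {a..b} f"
  shows "selfadjoint (fun_calc f A)"
proof -
  obtain P where P: "uniform_limit {a..b} (\<lambda>n. poly (P n)) f sequentially"
    using uniform_polynomial_approximation[OF assms] .
  have "fun_calc f A \<in> {T. selfadjoint T}"
    by (rule closed_sequentially[OF closed_selfadjoint _ fun_calc_limit[OF A ab assms P]])
      (simp add: selfadjoint_op_poly A)
  then show ?thesis by simp
qed

text \<open>The same polynomials approximate both functions on the interval.\<close>

lemma fun_calc_cong:
  assumes f: "continuous_on {a..b} f" and "\<And>x. x \<in> {a..b} \<Longrightarrow> f x = g x"
  shows "fun_calc f A = fun_calc g A"
proof -
  obtain P where P: "uniform_limit {a..b} (\<lambda>n. poly (P n)) f sequentially"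
    using uniform_polynomial_approximation[OF f] .
  have g: "continuous_on {a..b} g" using f assms(2) continuous_on_cong[of "{a..b}" "{a..b}" f g] by blast
  have P': "uniform_limit {a..b} (\<lambda>n. poly (P n)) g sequentially"
    using P assms(2) by (simp add: uniform_limit_iff)
  show ?thesis
    using fun_calc_limit[OF A ab f P] fun_calc_limit[OF A ab g P'] by (rule LIMSEQ_unique)
qed

lemma fun_calc_poly: "fun_calc (poly P) A = op_poly P A"
proof -
  have "(\<lambda>n. op_poly P A) \<longlonglongrightarrow> fun_calc (poly P) A"
    by (rule fun_calc_limit[OF A ab]) (auto intro: continuous_intros uniform_limit_const)
  then show ?thesis by (simp add: LIMSEQ_const_iff)
qed

lemma fun_calc_id: "fun_calc (\<lambda>t. t) A = A"
proof -
  have "(\<lambda>t::real. t) = poly [:0, 1:]" by auto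
  then show ?thesis using fun_calc_poly[of "[:0, 1:]"] by simp
qed

lemma fun_calc_const: "fun_calc (\<lambda>t. c) A = c *\<^sub>R id_blinfun"
proof -
  have "(\<lambda>t::real. c) = poly [:c:]" by auto
  then show ?thesis using fun_calc_poly[of "[:c:]"] by simp
qed

lemma fun_calc_add:
  assumes f: "continuous_on {a..b} f" and g: "continuous_on {a..b} g"
  shows "fun_calc (\<lambda>t. f t + g t) A = fun_calc f A + fun_calc g A"
proof -
  obtain P Q where P: "uniform_limit {a..b} (\<lambda>n. poly (P n)) f sequentially"
    and Q: "uniform_limit {a..b} (\<lambda>n. poly (Q n)) g sequentially"
    by (metis uniform_polynomial_approximation f g)
  have "uniform_limit {a..b} (\<lambda>n. poly (P n + Q n)) (\<lambda>t. f t + g t) sequentially"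
    using uniform_limit_add[OF P Q] by (simp add: uniform_limit_iff)
  from fun_calc_limit[OF A ab continuous_on_add[OF f g] this]
  have "(\<lambda>n. op_poly (P n) A + op_poly (Q n) A) \<longlonglongrightarrow> fun_calc (\<lambda>t. f t + g t) A"
    by (simp add: op_poly_add)
  then show ?thesis
    using tendsto_add[OF fun_calc_limit[OF A ab f P] fun_calc_limit[OF A ab g Q]]
    by (rule LIMSEQ_unique)
qed

lemma fun_calc_mult:
  assumes f: "continuous_on {a..b} f" and g: "continuous_on {a..b} g"
  shows "fun_calc (\<lambda>t. f t * g t) A = fun_calc f A o\<^sub>L fun_calc g A"
proof -
  obtain P Q where P: "uniform_limit {a..b} (\<lambda>n. poly (P n)) f sequentially"
    and Q: "uniform_limit {a..b} (\<lambda>n. poly (Q n)) g sequentially"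
    by (metis uniform_polynomial_approximation f g)
  \<comment> \<open>Uniform convergence of products requires bounded limits; compactness of the
    interval supplies this.\<close>
  have "bounded (f ` {a..b})" "bounded (g ` {a..b})"
    by (intro compact_imp_bounded compact_continuous_image f g compact_Icc)+
  from uniform_lim_mult[OF P Q this]
  have "uniform_limit {a..b} (\<lambda>n. poly (P n * Q n)) (\<lambda>t. f t * g t) sequentially"
    by (simp add: uniform_limit_iff)
  from fun_calc_limit[OF A ab continuous_on_mult[OF f g] this]
  have "(\<lambda>n. op_poly (P n) A o\<^sub>L op_poly (Q n) A) \<longlonglongrightarrow> fun_calc (\<lambda>t. f t * g t) A"
    by (simp add: op_poly_mult)
  then show ?thesis
    using bounded_bilinear.tendsto[OF bounded_bilinear_blinfun_compose
        fun_calc_limit[OF A ab f P] fun_calc_limit[OF A ab g Q]]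
    by (rule LIMSEQ_unique)
qed

lemma fun_calc_scale:
  assumes "continuous_on {a..b} f"
  shows "fun_calc (\<lambda>t. c * f t) A = c *\<^sub>R fun_calc f A"
  using fun_calc_mult[OF continuous_on_const assms, of c]
  by (auto intro!: blinfun_eqI simp: fun_calc_const blinfun.scaleR_left)

lemma fun_calc_diff:
  assumes "continuous_on {a..b} f" "continuous_on {a..b} g"
  shows "fun_calc (\<lambda>t. f t - g t) A = fun_calc f A - fun_calc g A"
  using fun_calc_add[OF assms(1), of "\<lambda>t. - 1 * g t"] fun_calc_scale[OF assms(2), of "-1"] assms(2)
  by (simp add: continuous_on_minus)

text \<open>The square root of \<open>f\<close> gives a self-adjoint \<open>S\<close> with
  \<open>f(A) = S o\<^sub>L S\<close>, so the quadratic form is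
  \<open>S x \<bullet> S x\<close>.\<close>

lemma positive_op_fun_calc:
  assumes f: "continuous_on {a..b} f" and nonneg: "\<And>t. t \<in> {a..b} \<Longrightarrow> 0 \<le> f t"
  shows "positive_op (fun_calc f A)"
proof -
  have s: "continuous_on {a..b} (\<lambda>t. sqrt (f t))" by (intro continuous_intros f)
  define S where "S = fun_calc (\<lambda>t. sqrt (f t)) A"
  have S: "selfadjoint S" unfolding S_def by (rule selfadjoint_fun_calc[OF s])
  have "fun_calc f A = fun_calc (\<lambda>t. sqrt (f t) * sqrt (f t)) A"
    by (rule fun_calc_cong[OF f]) (simp add: nonneg)
  also have "\<dots> = S o\<^sub>L S" unfolding S_def by (rule fun_calc_mult[OF s s])
  finally have eq: "fun_calc f A = S o\<^sub>L S" .
  have "fun_calc f A x \<bullet> x = S x \<bullet> S x" for x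
    using S unfolding eq by (simp add: selfadjoint_iff_inner)
  then show ?thesis using selfadjoint_fun_calc[OF f] by (simp add: positive_op_iff_inner)
qed

lemma is_op_inverse_fun_calc:
  assumes f: "continuous_on {a..b} f" and g: "continuous_on {a..b} g"
    and fg: "\<And>t. t \<in> {a..b} \<Longrightarrow> f t * g t = 1"
  shows "is_op_inverse (fun_calc f A) (fun_calc g A)"
proof -
  have "fun_calc (\<lambda>t. f t * g t) A = id_blinfun"
    using fun_calc_cong[OF continuous_on_mult[OF f g], of "\<lambda>t. 1"] fg by (simp add: fun_calc_const)
  moreover have "fun_calc (\<lambda>t. g t * f t) A = id_blinfun"
    using fun_calc_cong[OF continuous_on_mult[OF g f], of "\<lambda>t. 1"] fg
    by (simp add: fun_calc_const mult.commute)
  ultimately show ?thesis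
    using selfadjoint_fun_calc[OF g]
    by (simp add: is_op_inverse_def selfadjoint_def fun_calc_mult f g)
qed

end

lemma is_op_inverse_sandwich:
  assumes R: "is_op_inverse R S" and X: "is_op_inverse X Y" and "R \<in> bop"
  shows "is_op_inverse (S o\<^sub>L X o\<^sub>L S) (R o\<^sub>L Y o\<^sub>L R)"
  using assms is_op_inverse_apply[OF R] is_op_inverse_apply[OF X]
  by (auto simp: is_op_inverse_def bop_compose intro!: blinfun_eqI)

section \<open>The inequality of means\<close>

text \<open>Write \<open>c = 1/t - 1\<close> and \<open>y = t powr r\<close>. The \<open>r\<close>-derivative is
  \<open>(y ln y - y + 1) / r\<^sup>2 - (c / (1 + r c))\<^sup>2\<close>; here \<open>r c / (1 + r c) \<ge> 1 - y\<close> by Bernoulli's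
  inequality \<open>1/y \<le> 1 + r c\<close>, and \<open>y ln y \<le> y (y - 1)\<close>.\<close>
lemma scalar_mean_gap_antimono:
  fixes t p q :: real
  assumes t: "0 < t" "t \<le> 1" and p: "0 < p" "p \<le> q" "q \<le> 1"
  shows "(t powr q - t / ((1 - q) * t + q)) / q \<le> (t powr p - t / ((1 - p) * t + p)) / p"
proof -
  define c where "c = 1 / t - 1"
  have c: "c \<ge> 0" using t by (simp add: c_def)
  define g where "g r = (t powr r - 1) / r + c / (1 + r * c)" for r
  \<comment> \<open>The harmonic term equals \<open>1 / (1 + r * c)\<close>. Splitting the numerator
    as \<open>(t powr r - 1) + (1 - 1 / (1 + r * c))\<close> makes the second quotient
    \<open>c / (1 + r * c)\<close>.\<close>
  have g_eq: "(t powr r - t / ((1 - r) * t + r)) / r = g r" if "r > 0" "r \<le> 1" for r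
  proof -
    have pos: "(1 - r) * t + r > 0" using that t by (simp add: add_nonneg_pos)
    have 1: "1 + r * c = ((1 - r) * t + r) / t"
      using t by (simp add: c_def field_simps)
    have "c * t = 1 - t" using t by (simp add: c_def field_simps)
    then have 2: "c / (1 + r * c) = (1 - t) / ((1 - r) * t + r)"
      unfolding 1 by simp
    have "(1 - t / ((1 - r) * t + r)) / r = (1 - t) / ((1 - r) * t + r)"
    proof -
      have "1 - t / ((1 - r) * t + r) = (((1 - r) * t + r) - t) / ((1 - r) * t + r)"
        using pos by (simp add: diff_divide_distrib)
      also have "((1 - r) * t + r) - t = r * (1 - t)" by (simp add: algebra_simps)
      finally show ?thesis using that by simp
    qed
    then show ?thesis unfolding g_def 2 by (simp add: diff_divide_distrib)
  qed
  have deriv: "(g has_real_derivative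
      ((ln t * t powr r) * r - (t powr r - 1)) / r\<^sup>2 - (c / (1 + r * c))\<^sup>2) (at r)"
    if "r > 0" for r
  proof -
    have "1 + r * c > 0" using that c by (simp add: add_pos_nonneg)
    then show ?thesis unfolding g_def using that t
      by (auto intro!: derivative_eq_intros simp: power2_eq_square field_simps)
  qed
  have neg: "((ln t * t powr r) * r - (t powr r - 1)) / r\<^sup>2 - (c / (1 + r * c))\<^sup>2 \<le> 0"
    if r: "r > 0" "r \<le> 1" for r
  proof -
    define y where "y = t powr r"
    have y: "y > 0" "y \<le> 1" using t r by (auto simp: y_def powr_le_one_le powr_le1)
    have lny: "ln y = r * ln t" using t by (simp add: y_def ln_powr)
    have "1 / y = (1 / t) powr r" using t by (simp add: y_def powr_divide)
    also have "\<dots> = (1 + c) powr r" by (simp add: c_def)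
    \<comment> \<open>Bernoulli's inequality as weighted AM-GM of \<open>1 + c\<close> and
      \<open>1\<close> with weights \<open>r\<close> and \<open>1 - r\<close>.\<close>
    also have "\<dots> \<le> 1 + r * c"
      using Youngs_inequality_0[of r "1 - r" "1 + c" 1] r c by (simp add: algebra_simps)
    finally have *: "1 / y \<le> 1 + r * c" .
    then have pos: "1 + r * c > 0" using y by (smt (verit) divide_pos_pos)
    have "1 - y \<le> r * (c / (1 + r * c))"
    proof -
      have "1 / (1 + r * c) \<le> y" using * y pos by (simp add: field_simps)
      moreover have "r * (c / (1 + r * c)) = 1 - 1 / (1 + r * c)" using pos by (simp add: field_simps)
      ultimately show ?thesis by simp
    qed
    then have "(1 - y)\<^sup>2 \<le> (r * (c / (1 + r * c)))\<^sup>2" using y by (intro power_mono) auto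
    moreover have "y * ln y - y + 1 \<le> (1 - y)\<^sup>2"
    proof -
      have "y * ln y \<le> y * (y - 1)" using y ln_le_minus_one[of y] by (intro mult_left_mono) auto
      then show ?thesis by (simp add: power2_eq_square algebra_simps)
    qed
    ultimately have "y * ln y - y + 1 \<le> r\<^sup>2 * (c / (1 + r * c))\<^sup>2"
      unfolding power_mult_distrib by linarith
    then have "(y * ln y - y + 1) / r\<^sup>2 \<le> (c / (1 + r * c))\<^sup>2"
      using r by (simp add: pos_divide_le_eq mult.commute)
    moreover have "(ln t * t powr r) * r - (t powr r - 1) = y * ln y - y + 1"
      by (simp add: lny flip: y_def)
    ultimately show ?thesis by (simp only: diff_le_0_iff_le)
  qed
  have "g q \<le> g p"
  proof (rule DERIV_nonpos_imp_nonincreasing[OF p(2)])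
    fix r assume "p \<le> r" "r \<le> q"
    then have "r > 0" "r \<le> 1" using p by auto
    then show "\<exists>y. (g has_real_derivative y) (at r) \<and> y \<le> 0" using deriv neg by blast
  qed
  then show ?thesis using g_eq p by simp
qed

theorem proposition4p3:
  fixes A B :: "'a::chilbert \<Rightarrow>\<^sub>L 'a" and u v p q :: real
  assumes "strictly_positive A" and "strictly_positive B"
    and "u > 0" and "v > 0" and "v \<le> 1"
    and "u *\<^sub>R A \<preceq> B" and "B \<preceq> v *\<^sub>R A"
    and "p \<in> {0<..1}" and "q \<in> {0<..1}" and "p \<le> q"
  shows "(1 / q) *\<^sub>R (geometric_mean q A B - harmonic_mean q A B)
         \<preceq> (1 / p) *\<^sub>R (geometric_mean p A B - harmonic_mean p A B)"
proof -
  have A: "selfadjoint A" and B: "selfadjoint B"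
    using assms(1,2) by (auto simp: strictly_positive_def positive_op_def)
  obtain a where a: "a > 0" "\<And>x. a * (x \<bullet> x) \<le> A x \<bullet> x"
    using strictly_positive_bounds[OF assms(1)] by blast
  have sp: "real_spectrum A \<subseteq> {a..norm A}"
    using A a by (intro real_spectrum_subset inner_le_norm_blinfun) (auto simp: selfadjoint_def)
  \<comment> \<open>A positive left endpoint keeps 0 out of the interval, so negative exponents are
    covered as well.\<close>
  have cont: "continuous_on {s..t} (\<lambda>x. x powr r)" if "s > 0" for s t r :: real
    using that by (intro continuous_on_powr' continuous_intros) auto
  define R where "R = op_powr A (1/2)"
  define S where "S = op_powr A (-1/2)"
  have R: "selfadjoint R" and S: "selfadjoint S"
    unfolding R_def S_def op_powr_def by (intro selfadjoint_fun_calc[OF A sp] cont a)+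
  have RS: "is_op_inverse R S"
    unfolding R_def S_def op_powr_def
    by (intro is_op_inverse_fun_calc[OF A sp] cont a) (use a in \<open>auto simp flip: powr_add\<close>)
  have RR: "R o\<^sub>L R = A"
  proof -
    have "R o\<^sub>L R = fun_calc (\<lambda>t. t powr (1/2) * t powr (1/2)) A"
      unfolding R_def op_powr_def by (intro fun_calc_mult[OF A sp, symmetric] cont a)
    also have "\<dots> = fun_calc (\<lambda>t. t) A"
      using a by (intro fun_calc_cong[OF A sp] continuous_intros cont) (auto simp flip: powr_add)
    finally show ?thesis by (simp add: fun_calc_id[OF A sp])
  qed
  have RSx: "R (S x) = x" "S (R x) = x" for x
    using is_op_inverse_apply[OF RS] by auto
  have RRx: "A x = R (R x)" for x
    using RR by (metis blinfun_apply_blinfun_compose)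
  have Rs: "R x \<bullet> y = x \<bullet> R y" and Ss: "S x \<bullet> y = x \<bullet> S y" for x y
    using R S by (auto simp: selfadjoint_iff_inner)
  have Rb: "R \<in> bop" using R by (simp add: selfadjoint_def)

  define X where "X = S o\<^sub>L B o\<^sub>L S"
  have X: "selfadjoint X" unfolding X_def by (rule selfadjoint_sandwich[OF S B])
  have spX: "real_spectrum X \<subseteq> {u..v}"
  proof (rule real_spectrum_subset)
    show "X \<in> bop" using X by (simp add: selfadjoint_def)
    fix x
    \<comment> \<open>Since \<open>S\<close> is the inverse square root of \<open>A\<close>,
      evaluating the two operator inequalities at \<open>S x\<close> turns \<open>A\<close> into the
      identity and \<open>B\<close> into \<open>X\<close>.\<close>
    have AS: "A (S x) \<bullet> S x = x \<bullet> x" by (simp add: RRx RSx Rs)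
    have "0 \<le> (B - u *\<^sub>R A) (S x) \<bullet> S x" "0 \<le> (v *\<^sub>R A - B) (S x) \<bullet> S x"
      using assms(6,7) by (auto simp: op_le_def positive_op_iff_inner)
    then show "u * (x \<bullet> x) \<le> X x \<bullet> x" "X x \<bullet> x \<le> v * (x \<bullet> x)"
      by (simp_all add: blinfun.diff_left blinfun.scaleR_left inner_diff_left AS X_def Ss)
  qed
  have BX: "B = R o\<^sub>L X o\<^sub>L R"
    by (rule blinfun_eqI) (simp add: X_def RSx)

  \<comment> \<open>\<open>h r\<close> represents the harmonic mean in the calculus of
    \<open>X\<close>, and \<open>f r\<close> the gap between the means divided by
    \<open>r\<close>.\<close>
  define h where "h r t = t / ((1 - r) * t + r)" for r t :: real
  define f where "f r t = (t powr r - h r t) / r" for r t :: real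
  have den: "(1 - r) * t + r > 0" if "r \<in> {0<..1}" "t \<in> {u..v}" for r t
    using that assms(3) by (simp add: add_nonneg_pos)
  have ch: "continuous_on {u..v} (h r)" if "r \<in> {0<..1}" for r
    unfolding h_def using den[OF that] by (intro continuous_intros) (metis less_irrefl)
  have cf: "continuous_on {u..v} (f r)" if "r \<in> {0<..1}" for r
    unfolding f_def using that assms(3) by (intro continuous_intros cont ch) auto

  \<comment> \<open>Both inverses factor through \<open>S\<close>: the weighted sum is
    \<open>S ((1 - r) + r X\<^sup>-\<^sup>1) S\<close>. Inverting it swaps \<open>S\<close> for
    \<open>R\<close> and the middle function for its reciprocal \<open>h r\<close>.\<close>
  have harm: "harmonic_mean r A B = R o\<^sub>L fun_calc (h r) X o\<^sub>L R" if r: "r \<in> {0<..1}" for r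
  proof -
    have invA: "op_inv A = S o\<^sub>L S"
      using RS A by (intro op_inv_eqI) (auto simp: is_op_inverse_def bop_compose RRx RSx intro!: blinfun_eqI)
    have cinv: "continuous_on {u..v} (\<lambda>t. 1 / t)"
      using assms(3) by (intro continuous_intros) auto
    have "is_op_inverse (fun_calc (\<lambda>t. t) X) (fun_calc (\<lambda>t. 1 / t) X)"
      using assms(3) by (intro is_op_inverse_fun_calc[OF X spX] cinv continuous_intros) auto
    then have XY: "is_op_inverse X (fun_calc (\<lambda>t. 1 / t) X)"
      by (simp add: fun_calc_id[OF X spX])
    have SR: "is_op_inverse S R" using RS Rb by (simp add: is_op_inverse_def)
    have "is_op_inverse B (S o\<^sub>L fun_calc (\<lambda>t. 1 / t) X o\<^sub>L S)"
      unfolding BX using S by (intro is_op_inverse_sandwich[OF SR XY]) (simp add: selfadjoint_def)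
    then have invB: "op_inv B = S o\<^sub>L fun_calc (\<lambda>t. 1 / t) X o\<^sub>L S" by (rule op_inv_eqI)
    have "fun_calc (\<lambda>t. (1 - r) + r * (1 / t)) X
        = (1 - r) *\<^sub>R id_blinfun + r *\<^sub>R fun_calc (\<lambda>t. 1 / t) X"
      by (simp only: fun_calc_add[OF X spX continuous_on_const continuous_on_mult[OF continuous_on_const cinv]]
          fun_calc_const[OF X spX] fun_calc_scale[OF X spX cinv])
    then have "(1 - r) *\<^sub>R op_inv A + r *\<^sub>R op_inv B
        = S o\<^sub>L fun_calc (\<lambda>t. (1 - r) + r * (1 / t)) X o\<^sub>L S"
      unfolding invA invB
      by (auto intro!: blinfun_eqI simp: blinfun.add_left blinfun.add_right blinfun.scaleR_left
          blinfun.scaleR_right)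
    moreover have "is_op_inverse (fun_calc (\<lambda>t. (1 - r) + r * (1 / t)) X) (fun_calc (h r) X)"
    proof (rule is_op_inverse_fun_calc[OF X spX _ ch[OF r]])
      show "continuous_on {u..v} (\<lambda>t. (1 - r) + r * (1 / t))"
        by (intro continuous_on_add continuous_on_mult cinv continuous_on_const)
      show "((1 - r) + r * (1 / t)) * h r t = 1" if "t \<in> {u..v}" for t
      proof -
        have "t > 0" using that assms(3) by simp
        then have "(1 - r) + r * (1 / t) = ((1 - r) * t + r) / t" by (simp add: add_divide_distrib)
        then show ?thesis unfolding h_def using den[OF r that] \<open>t > 0\<close> by simp
      qed
    qed
    ultimately show ?thesis
      unfolding harmonic_mean_def using is_op_inverse_sandwich[OF RS _ Rb] by (simp add: op_inv_eqI)
  qed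
  have gap: "(1 / r) *\<^sub>R (geometric_mean r A B - harmonic_mean r A B) = R o\<^sub>L fun_calc (f r) X o\<^sub>L R"
    if r: "r \<in> {0<..1}" for r
  proof -
    have "fun_calc (f r) X = fun_calc (\<lambda>t. (1 / r) * (t powr r - h r t)) X"
      by (simp add: f_def[abs_def])
    also have "\<dots> = (1 / r) *\<^sub>R (op_powr X r - fun_calc (h r) X)"
      unfolding op_powr_def
      by (subst fun_calc_scale[OF X spX])
        (auto intro!: continuous_intros cont ch r assms(3) simp: fun_calc_diff[OF X spX cont[OF assms(3)] ch[OF r]])
    finally show ?thesis
      unfolding harm[OF r] geometric_mean_def R_def[symmetric] S_def[symmetric] X_def[symmetric]
      by (auto intro!: blinfun_eqI simp: blinfun.diff_left blinfun.diff_right blinfun.scaleR_left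
          blinfun.scaleR_right)
  qed
  \<comment> \<open>The scalar inequality applies at each point of \<open>{u..v}\<close>, which lies
    in \<open>(0, 1]\<close> by \<open>u > 0\<close> and \<open>v \<le> 1\<close>.\<close>
  have "positive_op (fun_calc (\<lambda>t. f p t - f q t) X)"
  proof (rule positive_op_fun_calc[OF X spX])
    show "continuous_on {u..v} (\<lambda>t. f p t - f q t)"
      by (intro continuous_intros cf assms)
    show "0 \<le> f p t - f q t" if "t \<in> {u..v}" for t
      using scalar_mean_gap_antimono[of t p q] that assms by (simp add: f_def h_def)
  qed
  then have pos: "0 \<le> fun_calc (f p) X y \<bullet> y - fun_calc (f q) X y \<bullet> y" for y
    using assms(8,9) by (simp add: fun_calc_diff[OF X spX cf cf] positive_op_iff_inner
        blinfun.diff_left inner_diff_left)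
  have sa: "selfadjoint (R o\<^sub>L fun_calc (f r) X o\<^sub>L R)" if "r \<in> {0<..1}" for r
    by (intro selfadjoint_sandwich R selfadjoint_fun_calc[OF X spX] cf that)
  \<comment> \<open>Moving the outer \<open>R\<close> across the inner product leaves the form of
    the middle operator at \<open>R x\<close>, so \<open>pos\<close> applies with
    \<open>y = R x\<close>.\<close>
  show ?thesis
    unfolding gap[OF assms(8)] gap[OF assms(9)] op_le_def positive_op_iff_inner
    using sa[OF assms(8)] sa[OF assms(9)] selfadjoint_diff pos
    by (simp add: blinfun.diff_left inner_diff_left Rs)
qed

end
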